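(* Let $(S,\cdot)$ be an arbitrary semigroup and let $A\subseteq S$ be an $SCR$-set in $S$. Then for each $l\in\mathbb{N}$ the collection $\{(a_1,a_2,d)\in S\times S\times S: \{a_1d^ta_2: t\in\{1,2,\dots,l\}\}\subseteq A\}$ is a $CR$-set in the semigroup $S\times S\times S$ (with coordinatewise operation).
   Context: For a semigroup $T$, ${}^{\mathbb{N}}T$ denotes the set of functions $f:\mathbb{N}\to T$ and $\mathcal{P}_f(X)$ the set of finite nonempty subsets of $X$. A set $A\subseteq S$ is an $SCR$-set (strong combinatorially rich set) if for each $k\in\mathbb{N}$ there exists $r\in\mathbb{N}$ such that for each $F\in\mathcal{P}_f({}^{\mathbb{N}}S)$ with $|F|\le k$, there exist $(a_1,a_2)\in S^2$ and $t\in\mathbb{N}$ with $t\le r$ such that $a_1f(t)a_2\in A$ for each $f\in F$. A set $B\subseteq T$ in a semigroup $T$ is a $CR$-set (combinatorially rich set) if for each $k\in\mathbb{N}$ there exist $r\in\mathbb{N}$ and $m\in\mathbb{N}$ such that for each $F\in\mathcal{P}_f({}^{\mathbb{N}}T)$ with $|F|\le k$, there exist $(a_1,\dots,a_{m+1})\in T^{m+1}$ and $t_1<t_2<\dots<t_m\le r$ in $\mathbb{N}$ such that $a_1f(t_1)a_2f(t_2)\cdots a_mf(t_m)a_{m+1}\in B$ for each $f\in F$. *)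

theory Defs
  imports Main "HOL-Library.FuncSet"
begin

instantiation prod :: (times, times) times
begin

definition times_prod :: "'a \<times> 'b \<Rightarrow> 'a \<times> 'b \<Rightarrow> 'a \<times> 'b" where
  "times_prod x y = (fst x * fst y, snd x * snd y)"

instance ..

end

instance prod :: (semigroup_mult, semigroup_mult) semigroup_mult
  by standard (simp add: times_prod_def mult.assoc)

lemma times_Pair [simp]: "(a, b) * (c, d) = (a * c, b * d)"
  by (simp add: times_prod_def)

(* There is no unit, so x^n is meaningful only for n >= 1; the value at n = 0 is junk. *)
definition sg_power :: "'a::semigroup_mult \<Rightarrow> nat \<Rightarrow> 'a" where
  "sg_power x n = ((\<lambda>y. y * x) ^^ (n - 1)) x"

lemma sg_power_one: "sg_power x 1 = x"
  by (simp add: sg_power_def)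

lemma sg_power_Suc: "n \<ge> 1 \<Longrightarrow> sg_power x (Suc n) = sg_power x n * x"
  by (cases n) (simp_all add: sg_power_def)

(* The positive integers are {1..} :: nat set, and functions from them to T are the
   elements of {1..} \<rightarrow>\<^sub>E UNIV: extensionality makes card count functions on {1..} only. *)
abbreviation seqs :: "(nat \<Rightarrow> 'a) set" where
  "seqs \<equiv> {1..} \<rightarrow>\<^sub>E UNIV"

definition SCR_set :: "'a::semigroup_mult set \<Rightarrow> bool" where
  "SCR_set A \<longleftrightarrow>
    (\<forall>k\<ge>1. \<exists>r\<ge>1. \<forall>F. F \<subseteq> seqs \<and> finite F \<and> F \<noteq> {} \<and> card F \<le> k \<longrightarrow>
      (\<exists>a1 a2. \<exists>t\<ge>1. t \<le> r \<and> (\<forall>f\<in>F. a1 * f t * a2 \<in> A)))"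

(* cr_word a t f m = a_1 f(t_1) a_2 f(t_2) ... a_m f(t_m) a_{m+1}, with a and t indexed from 1. *)
primrec cr_word ::
  "(nat \<Rightarrow> 'a::semigroup_mult) \<Rightarrow> (nat \<Rightarrow> nat) \<Rightarrow> (nat \<Rightarrow> 'a) \<Rightarrow> nat \<Rightarrow> 'a" where
  "cr_word a t f 0 = a 1"
| "cr_word a t f (Suc m) = cr_word a t f m * f (t (Suc m)) * a (Suc m + 1)"

definition CR_set :: "'a::semigroup_mult set \<Rightarrow> bool" where
  "CR_set B \<longleftrightarrow>
    (\<forall>k\<ge>1. \<exists>r\<ge>1. \<exists>m\<ge>1. \<forall>F. F \<subseteq> seqs \<and> finite F \<and> F \<noteq> {} \<and> card F \<le> k \<longrightarrow>
      (\<exists>a t. t \<in> {1..m} \<rightarrow> {1..} \<and> strict_mono_on {1..m} t \<and> t m \<le> r \<and>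
        (\<forall>f\<in>F. cr_word a t f m \<in> B)))"

end

theory Submission
  imports Defs
begin

text \<open>Already words with a single variable factor (m = 1) suffice. Fix any c in S. For f = (p, q, e)
  and i in {1..l}, the SCR-property is applied to the at most k * l sequences
  g(t) = p(t) c (c e(t) c)^i c q(t). If u g(t) v lies in A for all of them, the word with outer
  coefficients (u, c, c) and (c, v, c) sends f to (u p(t) c, c q(t) v, c e(t) c).\<close>

theorem theorem2p8:
  fixes A :: "'a::semigroup_mult set" and l :: nat
  assumes "SCR_set A" and "l \<ge> 1"
  shows "CR_set {(a1, a2, d). {a1 * sg_power d t * a2 | t. t \<in> {1..l}} \<subseteq> A}"
    (is "CR_set ?B")
  unfolding CR_set_def
proof (intro allI impI)
  fix k :: nat
  assume "k \<ge> 1"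
  then have "k * l \<ge> 1" using assms(2) by simp
  \<comment> \<open>The bound \<open>k * l\<close> is fixed before any \<open>F\<close> is given, so
    the resulting \<open>r\<close> is uniform in \<open>F\<close>.\<close>
  with assms(1) have "\<exists>r\<ge>1. \<forall>G. G \<subseteq> seqs \<and> finite G \<and> G \<noteq> {} \<and> card G \<le> k * l \<longrightarrow>
      (\<exists>u v. \<exists>t\<ge>1. t \<le> r \<and> (\<forall>g\<in>G. u * g t * v \<in> A))"
    unfolding SCR_set_def by (elim allE[of _ "k * l"] impE)
  then obtain r where "r \<ge> 1"
    and r: "\<forall>G. G \<subseteq> seqs \<and> finite G \<and> G \<noteq> {} \<and> card G \<le> k * l \<longrightarrow>
      (\<exists>u v. \<exists>t\<ge>1. t \<le> r \<and> (\<forall>g\<in>G. u * g t * v \<in> A))"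
    by (elim exE conjE)
  \<comment> \<open>Types are inhabited, so \<open>undefined\<close> serves as an arbitrary element
    of S.\<close>
  define c :: 'a where "c = undefined"
  \<comment> \<open>The factors \<open>c\<close> stand where a unit would: each coordinate of an
    outer coefficient must be an element of S. Restriction to \<open>{1..}\<close> puts
    \<open>g (f, i)\<close> into \<open>seqs\<close>.\<close>
  define g :: "(nat \<Rightarrow> 'a \<times> 'a \<times> 'a) \<times> nat \<Rightarrow> nat \<Rightarrow> 'a" where
    "g = (\<lambda>(f, i). \<lambda>t\<in>{1..}. case f t of (p, q, e) \<Rightarrow>
      p * c * sg_power (c * e * c) i * (c * q))"
  have words: "\<exists>a t. t \<in> {1..1} \<rightarrow> {1..} \<and> strict_mono_on {1..1} t \<and> t 1 \<le> r \<and>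
      (\<forall>f\<in>F. cr_word a t f 1 \<in> ?B)"
    if F: "finite F" "F \<noteq> {}" "card F \<le> k" for F :: "(nat \<Rightarrow> 'a \<times> 'a \<times> 'a) set"
  proof -
    let ?G = "g ` (F \<times> {1..l})"
    \<comment> \<open>Different pairs may yield the same sequence, hence only an upper
      bound.\<close>
    have "card ?G \<le> card F * l"
      using card_image_le[of "F \<times> {1..l}" g] F(1) by (simp add: card_cartesian_product)
    also have "\<dots> \<le> k * l" using F(3) by simp
    finally have "card ?G \<le> k * l" .
    moreover have "?G \<subseteq> seqs" by (auto simp: g_def split: if_splits)
    moreover have "finite ?G" "?G \<noteq> {}" using F(1,2) assms(2) by auto
    ultimately have "\<exists>u v. \<exists>t\<ge>1. t \<le> r \<and> (\<forall>h\<in>?G. u * h t * v \<in> A)"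
      by (intro r[rule_format] conjI)
    then obtain u v t where t: "t \<ge> 1" "t \<le> r" and G: "\<forall>h\<in>?G. u * h t * v \<in> A"
      by (elim exE conjE)
    have uv: "u * g (f, i) t * v \<in> A" if "f \<in> F" "i \<in> {1..l}" for f i
      using G that by blast
    define a where "a = (\<lambda>j::nat. if j = 1 then (u, c, c) else (c, v, c))"
    have "cr_word a (\<lambda>_. t) f 1 \<in> ?B" if "f \<in> F" for f
    proof -
      obtain p q e where f: "f t = (p, q, e)" by (cases "f t") auto
      \<comment> \<open>The same \<open>u\<close>, \<open>v\<close>, \<open>t\<close> serve every
        exponent \<open>i\<close>. As \<open>t\<close> is positive, the restriction in
        \<open>g\<close> evaluates to its body, and regrouping gives the product required in
        \<open>?B\<close>.\<close>
      have "u * p * c * sg_power (c * e * c) i * (c * q * v) \<in> A" if "i \<in> {1..l}" for i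
        using uv[OF \<open>f \<in> F\<close> that] t(1) by (simp add: g_def f mult.assoc)
      then show ?thesis by (auto simp: a_def f)
    qed
    \<comment> \<open>On the single index in \<open>{1..1}\<close> a constant function is vacuously
      strictly increasing.\<close>
    then show ?thesis
      using t by (intro exI[of _ a] exI[of _ "\<lambda>_. t"] conjI ballI)
        (auto simp: strict_mono_on_def simp del: One_nat_def)
  qed
  show "\<exists>r\<ge>1. \<exists>m\<ge>1. \<forall>F. F \<subseteq> seqs \<and> finite F \<and> F \<noteq> {} \<and> card F \<le> k \<longrightarrow>
      (\<exists>a t. t \<in> {1..m} \<rightarrow> {1..} \<and> strict_mono_on {1..m} t \<and> t m \<le> r \<and>
        (\<forall>f\<in>F. cr_word a t f m \<in> ?B))"
    by (rule exI[of _ r], rule conjI[OF \<open>r \<ge> 1\<close>], rule exI[of _ 1],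
        intro conjI[OF order_refl] allI impI, elim conjE, rule words)
qed

end
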